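(* Let $(X,f)$ be a sensitive $\mathrm{ToM}$ system, where $X$ is a (nonempty) compact metric space with metric $d$ and $f:X\to X$ is continuous. Then $\mathbb{L}_r=\overline{\mathbb{L}}_r$.
   Context: A topological dynamical system $(X,f)$ is a nonempty compact metric space $(X,d)$ together with a continuous map $f:X\to X$. "Opene" means open and nonempty. $(X,f)$ is sensitive if there exists $\varepsilon>0$ such that for every $x\in X$ and every neighborhood $U_x$ of $x$ there exist $y\in U_x$ and an integer $n\ge 0$ with $d(f^n(x),f^n(y))>\varepsilon$. $(X,f)$ is topologically transitive if for any pair of opene subsets $U,V\subset X$ the set $\{n\in\mathbb{Z}_+ : U\cap f^{-n}(V)\neq\varnothing\}$ is infinite. A point $x\in X$ is transitive if its orbit $\{x,f(x),f^2(x),\dots\}$ is dense in $X$. A closed $f$-invariant subset $M\subset X$ is minimal if the orbit of every point of $M$ is dense in $M$; a point of $X$ is minimal if it belongs to some minimal subset. The system $(X,f)$ is called $\mathrm{ToM}$ if it is topologically transitive, $X$ has no isolated points, and every point $x\in X$ is either transitive or minimal (it is not required that both types of points be present; in particular, a minimal system on a space without isolated points is $\mathrm{ToM}$). The Lyapunov numbers in the claim are (suprema over real numbers $\varepsilon$): $$\mathbb{L}_r=\sup\{\varepsilon:\ \text{for every } x\in X \text{ and every neighborhood } U_x \text{ of } x \text{ there exist } y\in U_x \text{ and an integer } n\ge 0 \text{ with } d(f^n(x),f^n(y))>\varepsilon\},$$ $$\overline{\mathbb{L}}_r=\sup\{\varepsilon:\ \text{for every } x\in X \text{ and every open neighborhood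 } U_x \text{ of } x \text{ there exists } y\in U_x \text{ with } \limsup_{n\to\infty} d(f^n(x),f^n(y))>\varepsilon\}.$$ *)

theory Defs
  imports "HOL-Analysis.Analysis"
begin

text \<open>The space of a dynamical system is a subset \<open>X\<close> of a metric space type, carrying
  the subspace topology \<open>top_of_set X\<close>; values of \<open>f\<close> outside \<open>X\<close> are irrelevant.\<close>

definition dynamical_system :: "'a::metric_space set \<Rightarrow> ('a \<Rightarrow> 'a) \<Rightarrow> bool" where
  "dynamical_system X f \<longleftrightarrow> compact X \<and> X \<noteq> {} \<and> continuous_on X f \<and> f ` X \<subseteq> X"

definition opene_in :: "'a::metric_space set \<Rightarrow> 'a set \<Rightarrow> bool" where
  "opene_in X U \<longleftrightarrow> openin (top_of_set X) U \<and> U \<noteq> {}"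

definition nbhd_in :: "'a::metric_space set \<Rightarrow> 'a \<Rightarrow> 'a set \<Rightarrow> bool" where
  "nbhd_in X x N \<longleftrightarrow> N \<subseteq> X \<and> (\<exists>U. openin (top_of_set X) U \<and> x \<in> U \<and> U \<subseteq> N)"

definition separates_nearby :: "'a::metric_space set \<Rightarrow> ('a \<Rightarrow> 'a) \<Rightarrow> real \<Rightarrow> bool" where
  "separates_nearby X f \<epsilon> \<longleftrightarrow>
     (\<forall>x\<in>X. \<forall>U. nbhd_in X x U \<longrightarrow>
        (\<exists>y\<in>U. \<exists>n. dist ((f ^^ n) x) ((f ^^ n) y) > \<epsilon>))"

text \<open>The upper limit is taken in the extended reals, since \<^const>\<open>limsup\<close> needs a complete
  lattice; the distances are bounded, so it agrees with the real upper limit.\<close>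

definition limsup_separates_nearby :: "'a::metric_space set \<Rightarrow> ('a \<Rightarrow> 'a) \<Rightarrow> real \<Rightarrow> bool" where
  "limsup_separates_nearby X f \<epsilon> \<longleftrightarrow>
     (\<forall>x\<in>X. \<forall>U. openin (top_of_set X) U \<and> x \<in> U \<longrightarrow>
        (\<exists>y\<in>U. limsup (\<lambda>n. ereal (dist ((f ^^ n) x) ((f ^^ n) y))) > ereal \<epsilon>))"

definition sensitive :: "'a::metric_space set \<Rightarrow> ('a \<Rightarrow> 'a) \<Rightarrow> bool" where
  "sensitive X f \<longleftrightarrow> (\<exists>\<epsilon>>0. separates_nearby X f \<epsilon>)"

text \<open>For a nonempty compact \<open>X\<close> the sets below contain every negative real and are bounded above by
  the diameter of \<open>X\<close>, so the real-valued suprema are genuine.\<close>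

definition lyapunov_r :: "'a::metric_space set \<Rightarrow> ('a \<Rightarrow> 'a) \<Rightarrow> real" where
  "lyapunov_r X f = Sup {\<epsilon>. separates_nearby X f \<epsilon>}"

definition limsup_lyapunov_r :: "'a::metric_space set \<Rightarrow> ('a \<Rightarrow> 'a) \<Rightarrow> real" where
  "limsup_lyapunov_r X f = Sup {\<epsilon>. limsup_separates_nearby X f \<epsilon>}"

definition topologically_transitive :: "'a::metric_space set \<Rightarrow> ('a \<Rightarrow> 'a) \<Rightarrow> bool" where
  "topologically_transitive X f \<longleftrightarrow>
     (\<forall>U V. opene_in X U \<and> opene_in X V \<longrightarrow> infinite {n. U \<inter> ((f ^^ n) -` V \<inter> X) \<noteq> {}})"

definition forward_orbit :: "('a \<Rightarrow> 'a) \<Rightarrow> 'a \<Rightarrow> 'a set" where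
  "forward_orbit f x = range (\<lambda>n. (f ^^ n) x)"

definition transitive_point :: "'a::metric_space set \<Rightarrow> ('a \<Rightarrow> 'a) \<Rightarrow> 'a \<Rightarrow> bool" where
  "transitive_point X f x \<longleftrightarrow> x \<in> X \<and> X \<subseteq> closure (forward_orbit f x)"

definition minimal_subset :: "'a::metric_space set \<Rightarrow> ('a \<Rightarrow> 'a) \<Rightarrow> 'a set \<Rightarrow> bool" where
  "minimal_subset X f M \<longleftrightarrow>
     closedin (top_of_set X) M \<and> f ` M \<subseteq> M \<and> (\<forall>x\<in>M. M \<subseteq> closure (forward_orbit f x))"

definition minimal_point :: "'a::metric_space set \<Rightarrow> ('a \<Rightarrow> 'a) \<Rightarrow> 'a \<Rightarrow> bool" where
  "minimal_point X f x \<longleftrightarrow> (\<exists>M. minimal_subset X f M \<and> x \<in> M)"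

text \<open>The disjunction is inclusive: in a minimal system every point is both transitive and
  minimal.\<close>

definition ToM :: "'a::metric_space set \<Rightarrow> ('a \<Rightarrow> 'a) \<Rightarrow> bool" where
  "ToM X f \<longleftrightarrow>
     topologically_transitive X f \<and> (\<forall>x\<in>X. \<not> x isolated_in X) \<and>
     (\<forall>x\<in>X. transitive_point X f x \<or> minimal_point X f x)"

end

theory Submission
  imports Defs
begin

text \<open>
  Every \<open>\<epsilon>\<close> that is admissible for one of the two suprema is admissible for the other. Passing
  from the upper limit to a single time is trivial. For the converse, sensitivity at \<open>x\<close> gives a
  point \<open>y\<close> near \<open>x\<close> and a time \<open>n\<close> at which \<open>x\<close> and \<open>y\<close> are more than \<open>\<epsilon>\<close> apart. If the pair
  \<open>(x, y)\<close> is recurrent under \<open>f \<times> f\<close>, this separation recurs, at times \<open>n + k\<close> with arbitrarily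
  large return times \<open>k\<close>, and so it survives in the upper limit. Separation at time \<open>n\<close> is an open
  condition on \<open>y\<close>; hence it suffices that for every \<open>x \<in> X\<close> the set \<open>R\<close> of all \<open>v\<close> such that
  \<open>(x, v)\<close> is recurrent is dense in \<open>X\<close> (\<open>recurrent_partners_dense\<close> below).

  This density is where the dichotomy transitive/minimal enters. If \<open>x\<close> is transitive, then \<open>x\<close> is
  recurrent, since \<open>X\<close> has no isolated points, and therefore so are the pairs \<open>(x, f\<^sup>k x)\<close>; the
  orbit of \<open>x\<close> is dense and lies in \<open>R\<close>. If \<open>x\<close> lies in a minimal set \<open>M\<close>, let \<open>M'\<close> be any
  minimal set. A minimal subset of \<open>M \<times> M'\<close> under \<open>f \<times> f\<close> projects onto \<open>M\<close>, hence contains a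
  pair \<open>(x, v)\<close>, and points of compact minimal sets are recurrent: \<open>R\<close> meets every minimal set
  (\<open>recurrent_partner_in_minimal_subset\<close>). As \<open>R\<close> is invariant, its closure \<open>F\<close> contains every
  minimal point. Should \<open>F\<close> be a proper subset of \<open>X\<close>, it would consist of the non-transitive
  points exactly. But then an orbit that comes from outside a neighbourhood of \<open>F\<close> and stays close
  to \<open>F\<close> for a long time yields, in the limit, a point that is not in \<open>F\<close>, while all its later
  iterates stay close to \<open>F\<close>, so that it is not transitive. The lemma
  \<open>escape_from_neighbourhood\<close> makes this precise, by topological transitivity and compactness.
\<close>

section \<open>Recurrent points\<close>

definition recurrent :: "('b::metric_space \<Rightarrow> 'b) \<Rightarrow> 'b \<Rightarrow> bool" where
  "recurrent g p \<longleftrightarrow> (\<forall>e>0. \<forall>N. \<exists>n\<ge>N. dist ((g ^^ n) p) p < e)"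

lemma funpow_in_invariant: "f ` X \<subseteq> X \<Longrightarrow> x \<in> X \<Longrightarrow> (f ^^ n) x \<in> X"
  by (induction n) auto

lemma continuous_on_funpow:
  assumes "continuous_on X f" "f ` X \<subseteq> X"
  shows "continuous_on X (f ^^ n)"
proof (induction n)
  case 0
  show ?case by (simp add: id_def)
next
  case (Suc n)
  have "(f ^^ n) ` X \<subseteq> X" using funpow_in_invariant[OF assms(2)] by auto
  then have "continuous_on X (f \<circ> f ^^ n)"
    using Suc assms(1) by (intro continuous_on_compose) (auto intro: continuous_on_subset)
  then show ?case by simp
qed

lemma funpow_map_prod:
  fixes f :: "'b \<Rightarrow> 'b" and g :: "'c \<Rightarrow> 'c"
  shows "(map_prod f g ^^ n) (x, y) = ((f ^^ n) x, (g ^^ n) y)"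
  by (induction n) auto

text \<open>Recurrence passes to images under semiconjugacies. It is applied below to maps such as
  \<open>z \<mapsto> (z, f\<^sup>k z)\<close>.\<close>

lemma recurrent_semiconjugate:
  assumes inv: "g ` K \<subseteq> K" and p: "p \<in> K" and h: "continuous_on K h"
    and comm: "\<And>z. z \<in> K \<Longrightarrow> g' (h z) = h (g z)" and rec: "recurrent g p"
  shows "recurrent g' (h p)"
  unfolding recurrent_def
proof (intro allI impI)
  fix e :: real and N assume "e > 0"
  then obtain d where "d > 0" and d: "\<And>z. z \<in> K \<Longrightarrow> dist z p < d \<Longrightarrow> dist (h z) (h p) < e"
    using h p unfolding continuous_on_iff by metis
  have "(g' ^^ n) (h p) = h ((g ^^ n) p)" for n
    by (induction n) (simp_all add: comm funpow_in_invariant[OF inv p])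
  moreover obtain n where "n \<ge> N" "dist ((g ^^ n) p) p < d"
    using rec \<open>d > 0\<close> unfolding recurrent_def by blast
  ultimately show "\<exists>n\<ge>N. dist ((g' ^^ n) (h p)) (h p) < e"
    using d funpow_in_invariant[OF inv p] by metis
qed

lemma closure_orbit_subset:
  assumes "closed F" "f ` F \<subseteq> F" "v \<in> F"
  shows "closure (forward_orbit f v) \<subseteq> F"
  using assms funpow_in_invariant[OF assms(2,3)]
  by (intro closure_minimal) (auto simp: forward_orbit_def)

text \<open>In the absence of isolated points an initial segment of a dense orbit can be discarded.\<close>

lemma transitive_point_visits_late:
  assumes "transitive_point X f x" "z \<in> X" "\<not> z isolated_in X" "e > 0"
  shows "\<exists>n\<ge>N. dist ((f ^^ n) x) z < e"
proof (rule ccontr)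
  assume late: "\<not> ?thesis"
  have "z islimpt X" using assms(2,3) by (simp add: isolated_in_islimpt_iff)
  then have "z islimpt closure (forward_orbit f x)"
    using assms(1) islimpt_subset unfolding transitive_point_def by blast
  then have "z islimpt forward_orbit f x" by (simp add: limpt_of_closure)
  then have "infinite (forward_orbit f x \<inter> ball z e)"
    using \<open>e > 0\<close> by (simp add: islimpt_eq_infinite_ball)
  moreover have "forward_orbit f x \<inter> ball z e \<subseteq> (\<lambda>n. (f ^^ n) x) ` {..<N}"
  proof
    fix p assume "p \<in> forward_orbit f x \<inter> ball z e"
    then obtain n where "p = (f ^^ n) x" "dist ((f ^^ n) x) z < e"
      by (auto simp: forward_orbit_def dist_commute)
    then show "p \<in> (\<lambda>n. (f ^^ n) x) ` {..<N}" using late not_le by blast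
  qed
  ultimately show False using finite_subset by blast
qed

section \<open>Compact minimal sets\<close>

lemma compact_chain_Inter_nonempty:
  fixes C :: "'b::t2_space set set"
  assumes comp: "\<And>S. S \<in> C \<Longrightarrow> compact S \<and> S \<noteq> {}"
    and chain: "\<And>S T. S \<in> C \<Longrightarrow> T \<in> C \<Longrightarrow> S \<subseteq> T \<or> T \<subseteq> S" and "S \<in> C"
  shows "\<Inter>C \<noteq> {}"
proof -
  have "S \<inter> \<Inter>C \<noteq> {}"
  proof (rule compact_imp_fip)
    fix D assume "finite D" "D \<subseteq> C"
    then have "\<exists>T\<in>C. T \<subseteq> S \<inter> \<Inter>D"
    proof (induction D)
      case empty
      then show ?case using \<open>S \<in> C\<close> by auto
    next
      case (insert A D)
      then have "A \<in> C" "D \<subseteq> C" by simp_all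
      with insert.IH obtain T where T: "T \<in> C" "T \<subseteq> S \<inter> \<Inter>D" by metis
      have "T \<subseteq> A \<or> A \<subseteq> T" using chain T(1) \<open>A \<in> C\<close> by metis
      then show ?case
      proof
        assume "T \<subseteq> A"
        then have "T \<subseteq> S \<inter> \<Inter>(insert A D)" using T(2) by simp
        then show ?case using T(1) by metis
      next
        assume "A \<subseteq> T"
        then have "A \<subseteq> S \<inter> \<Inter>(insert A D)" using T(2) by (simp, meson subset_trans)
        then show ?case using \<open>A \<in> C\<close> by metis
      qed
    qed
    then show "S \<inter> \<Inter>D \<noteq> {}" using comp by blast
  qed (simp_all add: comp \<open>S \<in> C\<close> compact_imp_closed)
  then show ?thesis by blast
qed

text \<open>Minimality is expressed by inclusion here, as Zorn's lemma yields it.\<close>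

lemma exists_minimal_invariant_subset:
  fixes K :: "'b::metric_space set"
  assumes "compact K" "K \<noteq> {}" "g ` K \<subseteq> K"
  obtains L where "compact L" "L \<noteq> {}" "g ` L \<subseteq> L" "L \<subseteq> K"
    "\<And>L'. compact L' \<Longrightarrow> L' \<noteq> {} \<Longrightarrow> g ` L' \<subseteq> L' \<Longrightarrow> L' \<subseteq> L \<Longrightarrow> L' = L"
proof -
  define A where "A = {L. compact L \<and> L \<noteq> {} \<and> g ` L \<subseteq> L \<and> L \<subseteq> K}"
  have "\<exists>m\<in>A. \<forall>a\<in>A. a \<subseteq> m \<longrightarrow> a = m"
  proof (rule predicate_Zorn)
    show "partial_order_on A (relation_of (\<lambda>S T. T \<subseteq> S) A)"
      by (rule partial_order_on_relation_ofI) auto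
  next
    fix C assume C: "C \<in> Chains (relation_of (\<lambda>S T. T \<subseteq> S) A)"
    show "\<exists>u\<in>A. \<forall>a\<in>C. u \<subseteq> a"
    proof (cases "C = {}")
      case True
      then show ?thesis using assms by (auto simp: A_def)
    next
      case False
      have sub: "C \<subseteq> A" and chain: "\<And>S T. S \<in> C \<and> T \<in> C \<Longrightarrow> S \<subseteq> T \<or> T \<subseteq> S"
        using C unfolding Chains_def relation_of_def by blast+
      obtain S where "S \<in> C" using False by blast
      then have "compact (S \<inter> \<Inter>C)"
        using sub by (intro compact_Int_closed closed_Inter) (auto simp: A_def compact_imp_closed)
      moreover have "S \<inter> \<Inter>C = \<Inter>C" using \<open>S \<in> C\<close> by blast
      ultimately have "compact (\<Inter>C)" by simp
      moreover have "\<Inter>C \<noteq> {}"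
        using sub chain \<open>S \<in> C\<close> by (intro compact_chain_Inter_nonempty[of C S]) (auto simp: A_def)
      moreover have "g ` \<Inter>C \<subseteq> \<Inter>C" "\<Inter>C \<subseteq> K"
        using sub False by (fastforce simp: A_def)+
      ultimately show ?thesis unfolding A_def by blast
    qed
  qed
  then obtain L where L: "L \<in> A" and min: "\<And>a. a \<in> A \<Longrightarrow> a \<subseteq> L \<Longrightarrow> a = L" by blast
  show ?thesis
  proof (rule that)
    show "compact L" "L \<noteq> {}" "g ` L \<subseteq> L" "L \<subseteq> K" using L by (simp_all add: A_def)
    fix L' assume L': "compact L'" "L' \<noteq> {}" "g ` L' \<subseteq> L'" "L' \<subseteq> L"
    then have "L' \<in> A" using \<open>L \<subseteq> K\<close> by (simp add: A_def)
    then show "L' = L" using min L'(4) by blast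
  qed
qed

text \<open>The closure of any tail of the orbit of \<open>p\<close> is a nonempty closed invariant subset, hence
  everything, and so contains \<open>p\<close>.\<close>

lemma recurrent_in_minimal:
  fixes L :: "'b::metric_space set"
  assumes L: "compact L" "g ` L \<subseteq> L" "continuous_on L g" and p: "p \<in> L"
    and min: "\<And>L'. compact L' \<Longrightarrow> L' \<noteq> {} \<Longrightarrow> g ` L' \<subseteq> L' \<Longrightarrow> L' \<subseteq> L \<Longrightarrow> L' = L"
  shows "recurrent g p"
  unfolding recurrent_def
proof (intro allI impI)
  fix e :: real and N assume "e > 0"
  define T where "T = (\<lambda>n. (g ^^ n) p) ` {N..}"
  have T: "T \<subseteq> L" using funpow_in_invariant[OF L(2) p] by (auto simp: T_def)
  have cl: "closure T \<subseteq> L" using T L(1) by (simp add: closure_minimal compact_imp_closed)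
  have "g ` T \<subseteq> T"
  proof
    fix z assume "z \<in> g ` T"
    then obtain n where "n \<ge> N" "z = (g ^^ Suc n) p" by (auto simp: T_def)
    then show "z \<in> T" unfolding T_def using le_SucI by blast
  qed
  then have "g ` closure T \<subseteq> closure T"
    using continuous_on_subset[OF L(3) cl] closure_subset
    by (intro image_closure_subset) auto
  moreover have "compact (closure T)"
    using cl L(1) by (metis closed_closure compact_Int_closed inf.absorb_iff2)
  moreover have "closure T \<noteq> {}" by (auto simp: T_def)
  ultimately have "p \<in> closure T" using min cl p by blast
  then obtain z where "z \<in> T" "dist z p < e"
    using \<open>e > 0\<close> unfolding closure_approachable by blast
  then show "\<exists>n\<ge>N. dist ((g ^^ n) p) p < e" by (auto simp: T_def)
qed

text \<open>A pair of points of minimal sets need not be recurrent, but one of the two may be prescribed: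
  a minimal subset of the product projects onto the first factor.\<close>

lemma recurrent_partner_in_minimal_subset:
  assumes dyn: "dynamical_system X f" and M: "minimal_subset X f M" and x: "x \<in> M"
    and M': "minimal_subset X f M'" "M' \<noteq> {}"
  obtains v where "v \<in> M'" "recurrent (map_prod f f) (x, v)"
proof -
  let ?g = "map_prod f f"
  have X: "compact X" "continuous_on X f" using dyn by (auto simp: dynamical_system_def)
  have sub: "M \<subseteq> X" "M' \<subseteq> X" and comp: "compact M" "compact M'"
    and inv: "f ` M \<subseteq> M" "f ` M' \<subseteq> M'"
    using M M' X closedin_compact closedin_imp_subset unfolding minimal_subset_def by metis+
  have "compact (M \<times> M')" "M \<times> M' \<noteq> {}" "?g ` (M \<times> M') \<subseteq> M \<times> M'"
    using comp inv x M'(2) by (auto intro: compact_Times)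
  then obtain L where L: "compact L" "L \<noteq> {}" "?g ` L \<subseteq> L" "L \<subseteq> M \<times> M'"
    and min: "\<And>L'. compact L' \<Longrightarrow> L' \<noteq> {} \<Longrightarrow> ?g ` L' \<subseteq> L' \<Longrightarrow> L' \<subseteq> L \<Longrightarrow> L' = L"
    using exists_minimal_invariant_subset[of "M \<times> M'" ?g] by blast
  have L_X: "L \<subseteq> X \<times> X" using L(4) sub by blast
  have "continuous_on L (\<lambda>p. (f (fst p), f (snd p)))"
    using L_X by (intro continuous_on_Pair continuous_on_compose2[OF X(2)] continuous_intros) auto
  then have cont: "continuous_on L ?g"
    by (simp add: map_prod_def case_prod_beta')
  have "closed (fst ` L)"
    using L(1) by (intro compact_imp_closed compact_continuous_image continuous_intros)
  moreover have "f ` fst ` L \<subseteq> fst ` L"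
  proof
    fix z assume "z \<in> f ` fst ` L"
    then obtain a b where "(a, b) \<in> L" "z = f a" by auto
    then have "(z, f b) \<in> L" using L(3) by auto
    then show "z \<in> fst ` L" by force
  qed
  moreover obtain z where z: "z \<in> fst ` L" "z \<in> M" using L(2,4) by fastforce
  ultimately have "closure (forward_orbit f z) \<subseteq> fst ` L" by (intro closure_orbit_subset)
  moreover have "x \<in> closure (forward_orbit f z)"
    using M x z(2) unfolding minimal_subset_def by blast
  ultimately obtain v where "(x, v) \<in> L" by auto
  moreover from this have "recurrent ?g (x, v)"
    by (intro recurrent_in_minimal[OF L(1,3) cont _ min])
  ultimately show ?thesis using that L(4) by blast
qed

section \<open>Density of the recurrent partners of a point\<close>

text \<open>Topological transitivity yields orbits that start farther than \<open>\<delta>\<close> from \<open>F\<close> and later stay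
  close to \<open>F\<close> for any prescribed time. As the prescribed time grows, the last points
  outside the \<open>\<delta>\<close>-neighbourhood of \<open>F\<close> before these stays accumulate at the desired point \<open>w\<close>.\<close>

lemma escape_from_neighbourhood:
  assumes dyn: "dynamical_system X f" and trans: "topologically_transitive X f"
    and F: "F \<subseteq> X" "F \<noteq> {}" "f ` F \<subseteq> F" and "\<delta> > 0" and a: "a \<in> X" "infdist a F > \<delta>"
  obtains w where "w \<in> X" "infdist w F \<ge> \<delta>" "\<And>i. i \<ge> 1 \<Longrightarrow> infdist ((f ^^ i) w) F \<le> \<delta>"
proof -
  have X: "compact X" "continuous_on X f" "f ` X \<subseteq> X"
    using dyn by (auto simp: dynamical_system_def)
  have cont: "continuous_on X (\<lambda>w. infdist ((f ^^ i) w) F)" for i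
    by (intro continuous_on_infdist continuous_on_funpow X)
  define H where "H n = {w \<in> X. infdist w F \<ge> \<delta> \<and> (\<forall>i\<in>{1..n}. infdist ((f ^^ i) w) F \<le> \<delta>)}"
    for n
  have compact_H: "compact (H n)" for n
  proof -
    let ?C = "\<lambda>i. {w \<in> X. infdist ((f ^^ i) w) F \<le> \<delta>}"
    have "closed {w \<in> X. \<delta> \<le> infdist w F}"
      using cont[of 0] X(1)
      by (intro continuous_on_closed_Collect_le continuous_on_const)
        (auto intro: compact_imp_closed)
    moreover have "closed (?C i)" for i
      using cont[of i] X(1) by (intro continuous_on_closed_Collect_le)
        (auto intro: compact_imp_closed)
    moreover have "H n = X \<inter> ({w \<in> X. \<delta> \<le> infdist w F} \<inter> (\<Inter>i\<in>{1..n}. ?C i))"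
      unfolding H_def by auto
    ultimately show ?thesis using X(1) by (auto intro!: compact_Int_closed closed_Int closed_INT)
  qed
  have nonempty_H: "H n \<noteq> {}" for n
  proof -
    define U where "U = {z \<in> X. infdist z F > \<delta>}"
    define V where "V = {z \<in> X. \<forall>i\<in>{..n}. infdist ((f ^^ i) z) F < \<delta>}"
    have "openin (top_of_set X) U"
      using continuous_openin_preimage_gen[OF cont[of 0], of "{\<delta><..}"]
      by (simp add: U_def vimage_def Int_def)
    then have "opene_in X U" using a by (auto simp: opene_in_def U_def)
    have "openin (top_of_set X) (X \<inter> (\<lambda>w. infdist ((f ^^ i) w) F) -` {..<\<delta>})" for i
      by (intro continuous_openin_preimage_gen cont) simp
    then have "openin (top_of_set X) (\<Inter>i\<in>{..n}. X \<inter> (\<lambda>w. infdist ((f ^^ i) w) F) -` {..<\<delta>})"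
      by (intro openin_INT2) auto
    moreover have "(\<Inter>i\<in>{..n}. X \<inter> (\<lambda>w. infdist ((f ^^ i) w) F) -` {..<\<delta>}) = V"
      by (auto simp: V_def)
    moreover obtain p where p: "p \<in> F" using F(2) by blast
    then have "p \<in> V"
      using F(1) \<open>\<delta> > 0\<close> funpow_in_invariant[OF F(3) p] by (auto simp: V_def)
    ultimately have "opene_in X V" by (auto simp: opene_in_def)
    with \<open>opene_in X U\<close> have "infinite {k. U \<inter> ((f ^^ k) -` V \<inter> X) \<noteq> {}}"
      using trans unfolding topologically_transitive_def by blast
    then obtain k where "U \<inter> ((f ^^ k) -` V \<inter> X) \<noteq> {}" using infinite_imp_nonempty by blast
    then obtain z where z: "z \<in> X" "infdist z F > \<delta>" "(f ^^ k) z \<in> V" by (auto simp: U_def)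
    \<comment> \<open>After its last exit \<open>l\<close> before time \<open>k\<close> the orbit stays close to \<open>F\<close> until time \<open>k + n\<close>, hence
      for at least \<open>n\<close> steps.\<close>
    let ?P = "\<lambda>l. l \<le> k \<and> infdist ((f ^^ l) z) F \<ge> \<delta>"
    define l where "l = (GREATEST l. ?P l)"
    have "?P l"
      unfolding l_def by (rule GreatestI_nat[of ?P 0 k]) (use z in auto)
    have "infdist ((f ^^ j) z) F < \<delta>" if "l < j" "j \<le> k" for j
      using Greatest_le_nat[of ?P j k] that unfolding l_def by fastforce
    moreover have "infdist ((f ^^ j) z) F < \<delta>" if "k \<le> j" "j \<le> k + n" for j
    proof -
      have "(f ^^ j) z = (f ^^ (j - k)) ((f ^^ k) z)"
        using that(1) by (metis comp_apply funpow_add le_add_diff_inverse2)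
      moreover have "j - k \<in> {..n}" using that by auto
      ultimately show ?thesis using z(3) unfolding V_def by simp
    qed
    ultimately have "infdist ((f ^^ (i + l)) z) F < \<delta>" if "i \<ge> 1" "i \<le> n" for i
      using that \<open>?P l\<close> by (cases "i + l \<le> k") auto
    then have "(f ^^ l) z \<in> H n"
      using \<open>?P l\<close> funpow_in_invariant[OF X(3) z(1)] by (force simp: H_def funpow_add)
    then show ?thesis by blast
  qed
  have decreasing: "H n \<subseteq> H m" if "m \<le> n" for m n
    using that by (auto simp: H_def)
  have nested: "H m \<subseteq> H n \<or> H n \<subseteq> H m" for m n using decreasing linear by metis
  have "\<Inter>(range H) \<noteq> {}"
  proof (rule compact_chain_Inter_nonempty)
    show "compact S \<and> S \<noteq> {}" if "S \<in> range H" for S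
      using that compact_H nonempty_H by auto
    show "S \<subseteq> T \<or> T \<subseteq> S" if "S \<in> range H" "T \<in> range H" for S T
      using that nested by auto
    show "H 0 \<in> range H" by simp
  qed
  then obtain w where w: "\<And>n. w \<in> H n" by blast
  show ?thesis
  proof (rule that)
    show "w \<in> X" "infdist w F \<ge> \<delta>" using w[of 0] by (auto simp: H_def)
    show "infdist ((f ^^ i) w) F \<le> \<delta>" if "i \<ge> 1" for i
      using w[of i] that by (auto simp: H_def)
  qed
qed

text \<open>The set \<open>R\<close> is invariant, so its closure \<open>F\<close> is \<open>X\<close> as soon as it contains a transitive point.
  When \<open>F\<close> is proper, it consists of the non-transitive points, and \<open>escape_from_neighbourhood\<close>
  produces a point that is neither transitive nor in \<open>F\<close>.\<close>

lemma recurrent_partners_dense: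
  assumes dyn: "dynamical_system X f" and tom: "ToM X f" and x: "x \<in> X"
  shows "X \<subseteq> closure {v \<in> X. recurrent (map_prod f f) (x, v)}"
proof -
  let ?g = "map_prod f f"
  define R where "R = {v \<in> X. recurrent ?g (x, v)}"
  have X: "compact X" "continuous_on X f" "f ` X \<subseteq> X"
    using dyn by (auto simp: dynamical_system_def)
  have trans: "topologically_transitive X f" and noiso: "\<And>z. z \<in> X \<Longrightarrow> \<not> z isolated_in X"
    and dich: "\<And>z. z \<in> X \<Longrightarrow> transitive_point X f z \<or> minimal_point X f z"
    using tom by (auto simp: ToM_def)
  have "X \<subseteq> closure R"
  proof (cases "transitive_point X f x")
    case True
    then have "recurrent f x"
      using transitive_point_visits_late[OF True x noiso[OF x]] by (simp add: recurrent_def)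
    have "recurrent ?g (x, (f ^^ k) x)" for k
    proof (rule recurrent_semiconjugate[OF X(3) x, where h = "\<lambda>z. (z, (f ^^ k) z)"])
      show "recurrent f x" by fact
      show "continuous_on X (\<lambda>z. (z, (f ^^ k) z))"
        by (intro continuous_on_Pair continuous_on_id continuous_on_funpow X)
      show "?g (z, (f ^^ k) z) = (f z, (f ^^ k) (f z))" for z
        by (simp add: funpow_swap1)
    qed
    then have "forward_orbit f x \<subseteq> R"
      using funpow_in_invariant[OF X(3) x] by (auto simp: R_def forward_orbit_def)
    then show ?thesis using True closure_mono unfolding transitive_point_def by blast
  next
    case False
    then obtain M where M: "minimal_subset X f M" "x \<in> M"
      using dich x unfolding minimal_point_def by blast
    define F where "F = closure R"
    have "closure R \<subseteq> X"
      using X(1) by (intro closure_minimal compact_imp_closed) (auto simp: R_def)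
    then have F: "closed F" "F \<subseteq> X" by (simp_all add: F_def)
    have "f v \<in> R" if "v \<in> R" for v
    proof -
      have v: "v \<in> X" "recurrent ?g (x, v)" using that by (auto simp: R_def)
      have "recurrent ?g ((\<lambda>p. (fst p, f (snd p))) (x, v))"
      proof (rule recurrent_semiconjugate[where h = "\<lambda>p. (fst p, f (snd p))"])
        show "?g ` (X \<times> X) \<subseteq> X \<times> X" "(x, v) \<in> X \<times> X" "recurrent ?g (x, v)"
          using X(3) x v by auto
        show "continuous_on (X \<times> X) (\<lambda>p. (fst p, f (snd p)))"
          by (intro continuous_on_Pair continuous_on_compose2[OF X(2)] continuous_intros) auto
      qed auto
      then show ?thesis using v(1) X(3) by (auto simp: R_def)
    qed
    then have "f ` F \<subseteq> F"
      using continuous_on_subset[OF X(2) F(2)] closure_subset unfolding F_def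
      by (intro image_closure_subset) auto
    have orbit_F: "closure (forward_orbit f v) \<subseteq> F" if "v \<in> F" for v
      using closure_orbit_subset F(1) \<open>f ` F \<subseteq> F\<close> that by blast
    have minimal_F: "M' \<subseteq> F" if M': "minimal_subset X f M'" for M'
    proof (cases "M' = {}")
      case False
      then obtain v where "v \<in> M'" "recurrent ?g (x, v)"
        using recurrent_partner_in_minimal_subset[OF dyn M M'] by blast
      moreover have "M' \<subseteq> X" using M' closedin_imp_subset unfolding minimal_subset_def by blast
      ultimately have "v \<in> R" by (auto simp: R_def)
      then have "v \<in> F" using closure_subset[of R] by (auto simp: F_def)
      then show ?thesis
        using orbit_F M' \<open>v \<in> M'\<close> unfolding minimal_subset_def by blast
    qed simp
    show ?thesis
    proof (rule ccontr)
      assume "\<not> X \<subseteq> closure R"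
      then obtain a where a: "a \<in> X" "a \<notin> F" by (auto simp: F_def)
      have "F \<noteq> {}" using minimal_F M by blast
      define \<delta> where "\<delta> = infdist a F / 2"
      have "\<delta> > 0" using a F(1) \<open>F \<noteq> {}\<close> infdist_pos_not_in_closed unfolding \<delta>_def by force
      then have "infdist a F > \<delta>" by (simp add: \<delta>_def)
      obtain w where w: "w \<in> X" "infdist w F \<ge> \<delta>"
        "\<And>i. i \<ge> 1 \<Longrightarrow> infdist ((f ^^ i) w) F \<le> \<delta>"
        using escape_from_neighbourhood[OF dyn trans F(2) \<open>F \<noteq> {}\<close> \<open>f ` F \<subseteq> F\<close> \<open>\<delta> > 0\<close> a(1)
            \<open>infdist a F > \<delta>\<close>] by blast
      have "\<not> transitive_point X f w"
      proof
        assume "transitive_point X f w"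
        then obtain n where "n \<ge> 1" "dist ((f ^^ n) w) a < \<delta>"
          using transitive_point_visits_late a(1) noiso \<open>\<delta> > 0\<close> by blast
        moreover have "infdist a F \<le> infdist ((f ^^ n) w) F + dist a ((f ^^ n) w)"
          by (rule infdist_triangle)
        ultimately show False using w(3)[of n] by (simp add: \<delta>_def dist_commute)
      qed
      then have "w \<in> F" using dich w(1) minimal_F unfolding minimal_point_def by blast
      then show False using w(2) \<open>\<delta> > 0\<close> by simp
    qed
  qed
  then show ?thesis by (simp add: R_def)
qed

section \<open>Equality of the Lyapunov numbers\<close>

lemma limsup_separates_imp_separates:
  assumes "limsup_separates_nearby X f \<epsilon>"
  shows "separates_nearby X f \<epsilon>"
  unfolding separates_nearby_def
proof (intro ballI allI impI)
  fix x N assume "x \<in> X" "nbhd_in X x N"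
  then obtain U where "openin (top_of_set X) U" "x \<in> U" "U \<subseteq> N"
    unfolding nbhd_in_def by blast
  then obtain y where y: "y \<in> U" "limsup (\<lambda>n. ereal (dist ((f ^^ n) x) ((f ^^ n) y))) > ereal \<epsilon>"
    using assms \<open>x \<in> X\<close> unfolding limsup_separates_nearby_def by blast
  have "\<exists>n. dist ((f ^^ n) x) ((f ^^ n) y) > \<epsilon>"
  proof (rule ccontr)
    assume "\<not> ?thesis"
    then have "limsup (\<lambda>n. ereal (dist ((f ^^ n) x) ((f ^^ n) y))) \<le> ereal \<epsilon>"
      by (intro Limsup_bounded always_eventually) (auto simp: not_less)
    then show False using y(2) by simp
  qed
  then show "\<exists>y\<in>N. \<exists>n. dist ((f ^^ n) x) ((f ^^ n) y) > \<epsilon>" using y(1) \<open>U \<subseteq> N\<close> by blast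
qed

text \<open>Distances that occur along the orbit of a recurrent pair recur, up to any error: the map
  \<open>(a, b) \<mapsto> d (f\<^sup>n a, f\<^sup>n b)\<close> is continuous at \<open>(x, v)\<close> and is evaluated at late returns.\<close>

lemma limsup_dist_recurrent_pair:
  assumes dyn: "dynamical_system X f" and xv: "x \<in> X" "v \<in> X"
    and rec: "recurrent (map_prod f f) (x, v)"
  shows "ereal (dist ((f ^^ n) x) ((f ^^ n) v))
    \<le> limsup (\<lambda>k. ereal (dist ((f ^^ k) x) ((f ^^ k) v)))" (is "ereal ?d \<le> limsup ?D")
proof (rule ccontr)
  assume "\<not> ?thesis"
  then have "limsup ?D < ereal ?d" by (simp only: not_le)
  then obtain c where "limsup ?D < ereal c" "ereal c < ereal ?d" using ereal_dense2 by blast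
  then have c: "limsup ?D < ereal c" "c < ?d" by simp_all
  obtain K where K: "\<And>k. k \<ge> K \<Longrightarrow> dist ((f ^^ k) x) ((f ^^ k) v) < c"
    using Limsup_lessD[OF c(1)] by (auto simp: eventually_sequentially)
  have X: "continuous_on X f" "f ` X \<subseteq> X" using dyn by (auto simp: dynamical_system_def)
  let ?h = "\<lambda>p. dist ((f ^^ n) (fst p)) ((f ^^ n) (snd p))"
  have "continuous_on (X \<times> X) ?h"
    by (intro continuous_on_dist continuous_on_compose2[OF continuous_on_funpow[OF X]]
        continuous_intros) auto
  moreover have "(x, v) \<in> X \<times> X" "?d - c > 0" using xv c by auto
  ultimately obtain d where "d > 0" and d: "\<And>p. p \<in> X \<times> X \<Longrightarrow> dist p (x, v) < d \<Longrightarrow>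
      dist (?h p) (?h (x, v)) < ?d - c"
    unfolding continuous_on_iff by metis
  obtain k where "k \<ge> K" "dist ((map_prod f f ^^ k) (x, v)) (x, v) < d"
    using rec \<open>d > 0\<close> unfolding recurrent_def by blast
  then have "dist (?h ((f ^^ k) x, (f ^^ k) v)) (?h (x, v)) < ?d - c"
    using xv funpow_in_invariant[OF X(2)] by (intro d) (auto simp: funpow_map_prod)
  then have "dist ((f ^^ (n + k)) x) ((f ^^ (n + k)) v) > c"
    by (auto simp: dist_real_def funpow_add)
  then show False using K[of "n + k"] \<open>k \<ge> K\<close> by simp
qed

lemma separates_imp_limsup_separates:
  assumes dyn: "dynamical_system X f" and tom: "ToM X f" and sep: "separates_nearby X f \<epsilon>"
  shows "limsup_separates_nearby X f \<epsilon>"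
  unfolding limsup_separates_nearby_def
proof (intro ballI allI impI)
  fix x U assume x: "x \<in> X" and U: "openin (top_of_set X) U \<and> x \<in> U"
  have X: "continuous_on X f" "f ` X \<subseteq> X" using dyn by (auto simp: dynamical_system_def)
  have "nbhd_in X x U" using U openin_imp_subset unfolding nbhd_in_def by blast
  then obtain y n where y: "y \<in> U" "dist ((f ^^ n) x) ((f ^^ n) y) > \<epsilon>"
    using sep x unfolding separates_nearby_def by blast
  have "continuous_on X (\<lambda>z. dist ((f ^^ n) x) ((f ^^ n) z))"
    by (intro continuous_on_dist continuous_on_const continuous_on_funpow X)
  then have "openin (top_of_set X) (X \<inter> (\<lambda>z. dist ((f ^^ n) x) ((f ^^ n) z)) -` {\<epsilon><..})"
    by (rule continuous_openin_preimage_gen) simp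
  then have "openin (top_of_set X) (U \<inter> (X \<inter> (\<lambda>z. dist ((f ^^ n) x) ((f ^^ n) z)) -` {\<epsilon><..}))"
    using U openin_Int by blast
  then obtain T where T: "open T"
    "U \<inter> (X \<inter> (\<lambda>z. dist ((f ^^ n) x) ((f ^^ n) z)) -` {\<epsilon><..}) = X \<inter> T"
    unfolding openin_open by blast
  have "y \<in> X" using y(1) U openin_imp_subset by blast
  then have "y \<in> T" using T(2) y by auto
  then have "T \<inter> closure {v \<in> X. recurrent (map_prod f f) (x, v)} \<noteq> {}"
    using recurrent_partners_dense[OF dyn tom x] \<open>y \<in> X\<close> by blast
  then have "T \<inter> {v \<in> X. recurrent (map_prod f f) (x, v)} \<noteq> {}"
    using open_Int_closure_eq_empty[OF \<open>open T\<close>] by simp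
  then obtain v where v: "v \<in> X" "recurrent (map_prod f f) (x, v)" "v \<in> T" by blast
  then have "v \<in> U" "dist ((f ^^ n) x) ((f ^^ n) v) > \<epsilon>" using T(2) by auto
  then have "ereal \<epsilon> < ereal (dist ((f ^^ n) x) ((f ^^ n) v))" by simp
  also have "\<dots> \<le> limsup (\<lambda>n. ereal (dist ((f ^^ n) x) ((f ^^ n) v)))"
    by (rule limsup_dist_recurrent_pair[OF dyn x v(1,2)])
  finally show "\<exists>y\<in>U. limsup (\<lambda>n. ereal (dist ((f ^^ n) x) ((f ^^ n) y))) > ereal \<epsilon>"
    using \<open>v \<in> U\<close> by blast
qed

theorem theorem3p2:
  fixes X :: "'a::metric_space set" and f :: "'a \<Rightarrow> 'a"
  assumes "dynamical_system X f"
    and "sensitive X f"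
    and "ToM X f"
  shows "lyapunov_r X f = limsup_lyapunov_r X f"
proof -
  have "separates_nearby X f \<epsilon> \<longleftrightarrow> limsup_separates_nearby X f \<epsilon>" for \<epsilon>
    using separates_imp_limsup_separates[OF assms(1,3)] limsup_separates_imp_separates by blast
  then show ?thesis by (simp add: lyapunov_r_def limsup_lyapunov_r_def)
qed

end
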